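(* Let $u$ be the solution of the penalized problem $$\partial_{xx}u=\eta^{-1}H(x)\,(u-\tilde g),\quad x\in[-1,\infty),\qquad u(-1)=1,\quad u(\infty)=0,$$ and let $v$ be the solution of the non-penalized problem $\partial_{xx}v=0$ on $[-1,0]$ with $v(-1)=1$, $v(0)=0$, i.e. $v(x)=-x$. Suppose that $\tilde g$ is a bounded $C^{k+1}$ function that matches $k$ derivatives of $u$ at $x=0^-$, namely 1. $\tilde g(0)=0$; 2. $\tilde g'(0)=u'(0)$; 3. $\tilde g^{(m)}(0)=u^{(m)}(0^-)=0$ for $2\le m\le k$. Then the solution $u$ converges to $v$ as $$\max_{x\in[-1,0]}|u-v|=O\big(\eta^{(k+1)/2}\big)$$ in the limit $\eta\to 0$.
   Context: $\eta>0$ is the small penalty parameter; $u$ (and hence, through the matching conditions, $\tilde g$) depends on $\eta$. $H$ is the Heaviside function: $H(x)=0$ for $x<0$ and $H(x)=1$ for $x\ge 0$. The function $\tilde g$ is the extension function that $u$ is forced to track in the penalized region $x\ge 0$. Because $H$ is discontinuous, $u$ has one continuous derivative ($u\in C^1$), while higher derivatives are discontinuous across $x=0$; $u^{(m)}(0^-)$ denotes the limit of the $m$-th derivative of $u$ as $x\to 0$ from the physical domain $x<0$. The condition $u(\infty)=0$ means $u(x)\to 0$ as $x\to\infty$.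
   Formalization: Since g̃ depends on η, its bound and a bound on its (k+1)-st derivative on some fixed interval [0,δ] are assumed uniform in η; without this the claim fails, e.g. k=1, g̃(x)=a x φ(x/√η) with a cutoff φ gives an error of order √η. *)

theory Defs
  imports "HOL-Analysis.Analysis" "HOL-Library.Landau_Symbols"
begin

definition heaviside :: "real \<Rightarrow> real" where
  "heaviside x = (if x < 0 then 0 else 1)"

text \<open>
  Iterated derivatives relative to a set, one-sided at its endpoints. They are meaningful on
  intervals with more than one point, where the derivative relative to the set is unique.
\<close>

primrec higher_deriv_within :: "real set \<Rightarrow> nat \<Rightarrow> (real \<Rightarrow> real) \<Rightarrow> real \<Rightarrow> real" where
  "higher_deriv_within S 0 f = f"
| "higher_deriv_within S (Suc m) f =
     (\<lambda>x. vector_derivative (higher_deriv_within S m f) (at x within S))"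

definition Ck_on :: "nat \<Rightarrow> real set \<Rightarrow> (real \<Rightarrow> real) \<Rightarrow> bool" where
  "Ck_on n S f \<longleftrightarrow>
     (\<forall>m<n. higher_deriv_within S m f differentiable_on S) \<and>
     continuous_on S (higher_deriv_within S n f)"

text \<open>
  The right-hand side jumps at 0, so the equation is required away from 0 and the two pieces
  are joined by continuity of the solution and of its first derivative. The values of
  \<open>g\<close> on the negative half-line are irrelevant, being multiplied by 0.
\<close>

definition penalized_solution ::
    "real \<Rightarrow> (real \<Rightarrow> real) \<Rightarrow> (real \<Rightarrow> real) \<Rightarrow> bool" where
  "penalized_solution \<eta> g u \<longleftrightarrow>
     Ck_on 1 {-1..} u \<and>
     (\<forall>x\<in>{-1..} - {0}.
        (higher_deriv_within {-1..} 1 u has_real_derivative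
           inverse \<eta> * heaviside x * (u x - g x)) (at x within {-1..})) \<and>
     u (-1) = 1 \<and> (u \<longlongrightarrow> 0) at_top"

definition nonpenalized_solution :: "(real \<Rightarrow> real) \<Rightarrow> bool" where
  "nonpenalized_solution v \<longleftrightarrow>
     Ck_on 2 {-1..0} v \<and>
     (\<forall>x\<in>{-1..0}. higher_deriv_within {-1..0} 2 v x = 0) \<and>
     v (-1) = 1 \<and> v 0 = 0"

text \<open>
  The matching conditions at 0. Derivatives of \<open>g\<close> are taken from the right, those of
  \<open>u\<close> of order at least 2 as limits from the left.
\<close>

definition matches_at_0 :: "nat \<Rightarrow> (real \<Rightarrow> real) \<Rightarrow> (real \<Rightarrow> real) \<Rightarrow> bool" where
  "matches_at_0 k g u \<longleftrightarrow>
     g 0 = 0 \<and>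
     higher_deriv_within {0..} 1 g 0 = deriv u 0 \<and>
     (\<forall>m\<in>{2..k}. ((deriv ^^ m) u \<longlongrightarrow> higher_deriv_within {0..} m g 0) (at_left 0) \<and>
                 higher_deriv_within {0..} m g 0 = 0)"

end

theory Submission
  imports Defs
begin

text \<open>
  On \<open>[-1, 0]\<close> the solution is affine, so \<open>u - v = u 0 * (1 + x)\<close> and only \<open>u 0\<close> has to be estimated.
  Put \<open>s = sqrt \<eta>\<close> and \<open>a = u' 0 = u 0 - 1\<close>. On the penalized side \<open>q = (u' - a) + (u - a * x) / s\<close>
  satisfies \<open>q' = q / s - (g - a * x) / \<eta>\<close> and grows at most linearly, hence
  \<open>u 0 / s = q 0 = \<integral>x\<in>{0..}. (g x - a * x) * exp (- x / s) / \<eta>\<close>. By the matching conditions and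
  the bounds on \<open>g\<close>, the integrand is at most \<open>C * (1 + \<bar>a\<bar>) * x ^ (k + 1) * exp (- x / s) / \<eta>\<close>,
  which gives \<open>\<bar>u 0\<bar> \<le> C' * (2 + \<bar>u 0\<bar>) * s ^ (k + 1)\<close>; for small \<open>s\<close> the term \<open>\<bar>u 0\<bar>\<close> on the right
  is absorbed.
\<close>

section \<open>One-sided derivatives and mean value estimates\<close>

lemma higher_deriv_within_has_derivative:
  assumes "Ck_on n S f" "m < n" "x \<in> S"
  shows "(higher_deriv_within S m f has_real_derivative higher_deriv_within S (Suc m) f x)
    (at x within S)"
proof -
  have "higher_deriv_within S m f differentiable (at x within S)"
    using assms by (auto simp: Ck_on_def differentiable_on_def)
  then show ?thesis
    by (simp add: has_real_derivative_iff_has_vector_derivative vector_derivative_works)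
qed

lemma at_within_atLeast_interior:
  fixes a x :: real
  assumes "a < x"
  shows "at x within {a..} = at x"
  using assms by (intro at_within_interior) auto

text \<open>Differentiability is asked only in the open interval, so that the estimate applies to
  \<open>u'\<close> on intervals ending at 0, where the second derivative may jump.\<close>

lemma mvt_abs_bound:
  fixes f f' :: "real \<Rightarrow> real"
  assumes "a \<le> b" "continuous_on {a..b} f"
    and "\<And>x. a < x \<Longrightarrow> x < b \<Longrightarrow> (f has_real_derivative f' x) (at x)"
    and "\<And>x. a < x \<Longrightarrow> x < b \<Longrightarrow> \<bar>f' x\<bar> \<le> C"
  shows "\<bar>f b - f a\<bar> \<le> C * (b - a)"
proof (cases "a = b")
  case False
  then have "a < b" using assms(1) by simp
  have "(f has_derivative (*) (f' x)) (at x)" if "a < x" "x < b" for x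
    using assms(3)[OF that] by (simp add: has_field_derivative_def)
  from mvt[OF \<open>a < b\<close> assms(2) this]
  obtain z where z: "a < z" "z < b" "f b - f a = f' z * (b - a)" .
  have "\<bar>f b - f a\<bar> = (b - a) * \<bar>f' z\<bar>"
    using z(3) \<open>a < b\<close> by (simp add: abs_mult)
  also have "\<dots> \<le> (b - a) * C"
    using assms(4)[OF z(1,2)] \<open>a < b\<close> by (intro mult_left_mono) auto
  finally show ?thesis by (simp add: mult.commute)
qed auto

text \<open>Each application of the mean value estimate gains one factor \<open>x\<close>; the
  induction passes to the shifted family \<open>\<lambda>m. D (Suc m)\<close>. An abstract family
  \<open>D\<close> allows a line to be subtracted from \<open>g\<close> together with its
  derivatives.\<close>

lemma vanishing_derivs_bound:
  fixes D :: "nat \<Rightarrow> real \<Rightarrow> real"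
  assumes "\<And>m x. m \<le> k \<Longrightarrow> x \<ge> 0 \<Longrightarrow> (D m has_real_derivative D (Suc m) x) (at x within {0..})"
    and "\<And>m. m \<le> k \<Longrightarrow> D m 0 = 0"
    and "\<And>x. x \<in> {0..\<delta>} \<Longrightarrow> \<bar>D (Suc k) x\<bar> \<le> C"
    and "x \<in> {0..\<delta>}"
  shows "\<bar>D 0 x\<bar> \<le> C * x ^ Suc k"
  using assms
proof (induction k arbitrary: D x)
  case (0 D x)
  have "continuous_on {0..x} (D 0)"
    by (intro DERIV_continuous_on[of _ _ "D (Suc 0)"] DERIV_subset[OF 0(1)[of 0]]) auto
  moreover have "(D 0 has_real_derivative D (Suc 0) z) (at z)" if "0 < z" for z
    using 0(1)[of 0 z] that by (simp add: at_within_atLeast_interior)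
  ultimately have "\<bar>D 0 x - D 0 0\<bar> \<le> C * (x - 0)"
    using 0 by (intro mvt_abs_bound[where f' = "D (Suc 0)"]) auto
  then show ?case using 0 by simp
next
  case (Suc k D x)
  have C: "C \<ge> 0" using Suc.prems(3)[OF Suc.prems(4)] by linarith
  have *: "\<bar>D (Suc 0) z\<bar> \<le> C * z ^ Suc k" if "z \<in> {0..\<delta>}" for z
    using Suc.IH[of "\<lambda>m. D (Suc m)" z] Suc.prems that by auto
  have "continuous_on {0..x} (D 0)"
    by (intro DERIV_continuous_on[of _ _ "D (Suc 0)"] DERIV_subset[OF Suc.prems(1)[of 0]]) auto
  moreover have "(D 0 has_real_derivative D (Suc 0) z) (at z)" if "0 < z" for z
    using Suc.prems(1)[of 0 z] that by (simp add: at_within_atLeast_interior)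
  moreover have "\<bar>D (Suc 0) z\<bar> \<le> C * x ^ Suc k" if "0 < z" "z < x" for z
  proof -
    have "\<bar>D (Suc 0) z\<bar> \<le> C * z ^ Suc k" using that Suc.prems(4) by (intro *) auto
    also have "\<dots> \<le> C * x ^ Suc k" using that C by (intro mult_left_mono power_mono) auto
    finally show ?thesis .
  qed
  ultimately have "\<bar>D 0 x - D 0 0\<bar> \<le> C * x ^ Suc k * (x - 0)"
    using Suc.prems by (intro mvt_abs_bound[where f' = "D (Suc 0)"]) auto
  then show ?case using Suc.prems by (simp add: mult_ac)
qed

section \<open>Exponential weights and the growing mode\<close>

lemma power_times_exp_tendsto_0:
  fixes s :: real
  assumes "s > 0"
  shows "((\<lambda>x. x ^ n * exp (- (x / s))) \<longlongrightarrow> 0) at_top"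
proof -
  have "filterlim (\<lambda>x. x / s) at_top at_top"
    using assms filterlim_tendsto_pos_mult_at_top[of "\<lambda>_. 1 / s" "1 / s" at_top "\<lambda>x. x"]
    by (simp add: filterlim_ident)
  then have "((\<lambda>x. (x / s) ^ n / exp (x / s)) \<longlongrightarrow> 0) at_top"
    by (rule filterlim_compose[OF tendsto_power_div_exp_0])
  then have "((\<lambda>x. s ^ n * ((x / s) ^ n / exp (x / s))) \<longlongrightarrow> s ^ n * 0) at_top"
    by (rule tendsto_mult_left)
  then show ?thesis
    using assms by (simp add: power_divide exp_minus field_simps)
qed

text \<open>
  \<open>exp_tail s n x * exp (- x / s)\<close> is the tail \<open>\<integral>t\<in>{x..}. t ^ n * exp (- t / s)\<close>; the recursion is
  integration by parts.
\<close>

primrec exp_tail :: "real \<Rightarrow> nat \<Rightarrow> real \<Rightarrow> real" where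
  "exp_tail s 0 x = s"
| "exp_tail s (Suc n) x = s * x ^ Suc n + real (Suc n) * s * exp_tail s n x"

text \<open>The Gamma integral, from which the powers of \<open>s\<close> in the final rate
  arise.\<close>

lemma exp_tail_at_0: "exp_tail s n 0 = fact n * s ^ Suc n"
  by (induction n) (auto simp: algebra_simps)

text \<open>Makes \<open>K * exp_tail s n\<close> a comparison solution of
  \<open>q' = q / s - r\<close> for forcings \<open>r\<close> dominated by
  \<open>K * x ^ n\<close>.\<close>

lemma exp_tail_has_derivative:
  assumes "s > 0"
  shows "(exp_tail s n has_real_derivative (exp_tail s n x / s - x ^ n)) (at x)"
proof (induction n)
  case 0
  have "exp_tail s 0 = (\<lambda>x. s)" by auto
  then show ?case using assms by simp
next
  case (Suc n)
  have "exp_tail s (Suc n) = (\<lambda>x. s * x ^ Suc n + real (Suc n) * s * exp_tail s n x)"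
    by auto
  then show ?case
    using assms
    by (auto intro!: derivative_eq_intros Suc.IH simp del: power_Suc simp: divide_simps)
       (auto simp: algebra_simps)
qed

lemma exp_tail_times_exp_tendsto_0:
  assumes "s > 0"
  shows "((\<lambda>x. exp_tail s n x * exp (- (x / s))) \<longlongrightarrow> 0) at_top"
proof (induction n)
  case 0
  then show ?case
    using tendsto_mult_left[OF power_times_exp_tendsto_0[OF assms, of 0], of s] by simp
next
  case (Suc n)
  have "((\<lambda>x. s * (x ^ Suc n * exp (- (x / s)))
      + real (Suc n) * s * (exp_tail s n x * exp (- (x / s)))) \<longlongrightarrow>
      s * 0 + real (Suc n) * s * 0) at_top"
    by (intro tendsto_intros power_times_exp_tendsto_0 assms Suc.IH)
  then show ?case by (simp add: algebra_simps)
qed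

text \<open>With the integrating factor \<open>exp (- (x / s))\<close>, the difference between
  \<open>q\<close> and the comparison solution becomes nondecreasing. It tends to 0 at infinity, so
  it is at most 0 at the origin.\<close>

lemma unstable_mode_upper_bound:
  fixes q r :: "real \<Rightarrow> real"
  assumes s: "s > 0"
    and cont: "continuous_on {0..} q"
    and der: "\<And>x. x > 0 \<Longrightarrow> (q has_real_derivative (q x / s - r x)) (at x)"
    and r: "\<And>x. x > 0 \<Longrightarrow> r x \<le> K * x ^ n"
    and lim: "((\<lambda>x. q x * exp (- (x / s))) \<longlongrightarrow> 0) at_top"
  shows "q 0 \<le> K * fact n * s ^ Suc n"
proof -
  define \<phi> where "\<phi> x = (q x - K * exp_tail s n x) * exp (- (x / s))" for x
  have cont\<phi>: "continuous_on {0..x} \<phi>" for x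
    unfolding \<phi>_def
    by (intro continuous_intros continuous_on_subset[OF cont] continuous_at_imp_continuous_on ballI
        DERIV_isCont[OF exp_tail_has_derivative[OF s]]) (use s in auto)
  have der\<phi>: "(\<phi> has_real_derivative (K * x ^ n - r x) * exp (- (x / s))) (at x)" if "x > 0" for x
    unfolding \<phi>_def using s
    by (auto intro!: derivative_eq_intros der[OF that] exp_tail_has_derivative[OF s]
        simp: field_simps)
  have "\<phi> 0 \<le> \<phi> x" if "x \<ge> 0" for x
    using that
  proof (rule DERIV_nonneg_imp_increasing_open[OF _ _ cont\<phi>])
    fix z :: real assume "0 < z" "z < x"
    moreover have "(K * z ^ n - r z) * exp (- (z / s)) \<ge> 0"
      using r[OF \<open>0 < z\<close>] by simp
    ultimately show "\<exists>y. (\<phi> has_real_derivative y) (at z) \<and> 0 \<le> y"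
      using der\<phi> by blast
  qed
  moreover have "(\<phi> \<longlongrightarrow> 0) at_top"
    using tendsto_diff[OF lim tendsto_mult_left[OF exp_tail_times_exp_tendsto_0[OF s, of n], of K]]
    unfolding \<phi>_def by (simp add: algebra_simps)
  ultimately have "\<phi> 0 \<le> 0"
    by (intro tendsto_lowerbound[of \<phi> 0 at_top])
       (auto intro: eventually_mono[OF eventually_ge_at_top[of 0]])
  then show ?thesis by (simp add: \<phi>_def exp_tail_at_0 mult_ac)
qed

text \<open>
  Since \<open>q' = q / s - r\<close> has growing solutions, excluding that growth determines \<open>q 0\<close> as a
  weighted integral of \<open>r\<close>.
\<close>

lemma unstable_mode_bound:
  fixes q r :: "real \<Rightarrow> real"
  assumes s: "s > 0"
    and cont: "continuous_on {0..} q"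
    and der: "\<And>x. x > 0 \<Longrightarrow> (q has_real_derivative (q x / s - r x)) (at x)"
    and r: "\<And>x. x > 0 \<Longrightarrow> \<bar>r x\<bar> \<le> K * x ^ n"
    and lim: "((\<lambda>x. q x * exp (- (x / s))) \<longlongrightarrow> 0) at_top"
  shows "\<bar>q 0\<bar> \<le> K * fact n * s ^ Suc n"
proof -
  have "q 0 \<le> K * fact n * s ^ Suc n"
    using r by (intro unstable_mode_upper_bound[OF s cont der _ lim]) (auto dest: abs_le_D1)
  \<comment> \<open>The equation is linear, so the one-sided bound also applies to \<open>-q\<close>
    with forcing \<open>-r\<close>.\<close>
  moreover have "- q 0 \<le> K * fact n * s ^ Suc n"
  proof (rule unstable_mode_upper_bound[OF s, where q = "\<lambda>x. - q x" and r = "\<lambda>x. - r x"])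
    show "continuous_on {0..} (\<lambda>x. - q x)" by (intro continuous_intros cont)
    show "((\<lambda>x. - q x) has_real_derivative (- q x / s - (- r x))) (at x)" if "x > 0" for x
      using DERIV_minus[OF der[OF that]] by simp
    show "- r x \<le> K * x ^ n" if "x > 0" for x using r[OF that] by simp
    show "((\<lambda>x. - q x * exp (- (x / s))) \<longlongrightarrow> 0) at_top" using tendsto_minus[OF lim] by simp
  qed
  ultimately show ?thesis by linarith
qed

section \<open>Both solutions on the physical domain\<close>

lemma nonpenalized_solution_eq:
  assumes "nonpenalized_solution v" "x \<in> {-1..0}"
  shows "v x = - x"
proof -
  let ?S = "{-1..0::real}"
  let ?d = "higher_deriv_within ?S"
  have Ck: "Ck_on 2 ?S v" and zero: "\<And>x. x \<in> ?S \<Longrightarrow> ?d 2 v x = 0"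
    and bc: "v (-1) = 1" "v 0 = 0"
    using assms(1) by (auto simp: nonpenalized_solution_def)
  have "(?d 1 v has_real_derivative 0) (at x within ?S)" if "x \<in> ?S" for x
    using higher_deriv_within_has_derivative[OF Ck, of 1 x] zero[OF that] that
    by (simp add: numeral_2_eq_2)
  then obtain c where c: "\<And>x. x \<in> ?S \<Longrightarrow> ?d 1 v x = c"
    using has_field_derivative_zero_constant[of ?S "?d 1 v"] by auto
  have "((\<lambda>x. v x - c * x) has_real_derivative 0) (at x within ?S)" if "x \<in> ?S" for x
    using higher_deriv_within_has_derivative[OF Ck, of 0 x] c[OF that] that
    by (auto intro!: derivative_eq_intros)
  then obtain e where e: "\<And>x. x \<in> ?S \<Longrightarrow> v x - c * x = e"
    using has_field_derivative_zero_constant[of ?S "\<lambda>x. v x - c * x"] by auto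
  have "e = 0" "c = -1" using e[of "-1"] e[of 0] bc by auto
  then show ?thesis using e[OF assms(2)] by simp
qed

text \<open>Splits the Heaviside equation into one equation on each side of 0. The two are coupled
  only through \<open>u\<close> and a single \<open>u'\<close> that is continuous across 0.\<close>

lemma penalized_solution_derivs:
  assumes "penalized_solution \<eta> g u"
  obtains u' where
    "continuous_on {-1..} u'"
    "\<And>x. x \<ge> -1 \<Longrightarrow> (u has_real_derivative u' x) (at x within {-1..})"
    "\<And>x. -1 < x \<Longrightarrow> x < 0 \<Longrightarrow> (u' has_real_derivative 0) (at x)"
    "\<And>x. x > 0 \<Longrightarrow> (u' has_real_derivative (u x - g x) / \<eta>) (at x)"
proof
  let ?u' = "higher_deriv_within {-1..} 1 u"
  have Ck: "Ck_on 1 {-1..} u"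
    and eqn: "\<And>x. x \<ge> -1 \<Longrightarrow> x \<noteq> 0 \<Longrightarrow> (?u' has_real_derivative
           inverse \<eta> * heaviside x * (u x - g x)) (at x within {-1..})"
    using assms by (auto simp: penalized_solution_def)
  show "continuous_on {-1..} ?u'" using Ck by (simp add: Ck_on_def)
  show "(u has_real_derivative ?u' x) (at x within {-1..})" if "x \<ge> -1" for x
    using higher_deriv_within_has_derivative[OF Ck, of 0 x] that by simp
  show "(?u' has_real_derivative 0) (at x)" if "-1 < x" "x < 0" for x
    using eqn[of x] that by (simp add: at_within_atLeast_interior heaviside_def)
  show "(?u' has_real_derivative (u x - g x) / \<eta>) (at x)" if "x > 0" for x
    using eqn[of x] that
    by (simp add: at_within_atLeast_interior heaviside_def divide_inverse mult.commute)
qed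

text \<open>The slope is constant left of 0 and, by continuity of \<open>u'\<close>, equals the
  slope at 0; the boundary value at -1 then ties it to \<open>u 0\<close>.\<close>

lemma penalized_solution_affine:
  assumes "penalized_solution \<eta> g u" "x \<in> {-1..0}"
  shows "u x = - x + u 0 * (1 + x)" "deriv u 0 = u 0 - 1"
proof -
  obtain u' where cont: "continuous_on {-1..} u'"
    and der: "\<And>x. x \<ge> -1 \<Longrightarrow> (u has_real_derivative u' x) (at x within {-1..})"
    and der2: "\<And>x. -1 < x \<Longrightarrow> x < 0 \<Longrightarrow> (u' has_real_derivative 0) (at x)"
    using penalized_solution_derivs[OF assms(1)] by metis
  have m1: "u (-1) = 1" using assms(1) by (simp add: penalized_solution_def)
  \<comment> \<open>The mean value estimate with constant 0; continuity of \<open>u'\<close> carries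
    the constancy to both endpoints.\<close>
  have const: "u' z = u' 0" if "z \<in> {-1..0}" for z
    using mvt_abs_bound[of z 0 u' "\<lambda>_. 0" 0] that der2 continuous_on_subset[OF cont, of "{z..0}"]
    by force
  have aff: "u z = u 0 + u' 0 * z" if "z \<in> {-1..0}" for z
  proof -
    have "\<bar>(u 0 - u' 0 * 0) - (u z - u' 0 * z)\<bar> \<le> 0 * (0 - z)"
    proof (rule mvt_abs_bound[where f = "\<lambda>x. u x - u' 0 * x" and f' = "\<lambda>_. 0"])
      show "continuous_on {z..0} (\<lambda>x. u x - u' 0 * x)"
        using that by (intro continuous_intros DERIV_continuous_on[of _ u u'] DERIV_subset[OF der]) auto
      show "((\<lambda>x. u x - u' 0 * x) has_real_derivative 0) (at y)" if y: "z < y" "y < 0" for y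
      proof -
        have "(u has_real_derivative u' 0) (at y)"
          using der[of y] const[of y] y \<open>z \<in> _\<close> by (simp add: at_within_atLeast_interior)
        then show ?thesis by (auto intro!: derivative_eq_intros)
      qed
    qed (use that in auto)
    then show ?thesis by simp
  qed
  have u'0: "u' 0 = u 0 - 1" using aff[of "-1"] m1 by simp
  show "u x = - x + u 0 * (1 + x)" using aff[OF assms(2)] u'0 by (simp add: algebra_simps)
  show "deriv u 0 = u 0 - 1"
    using der[of 0] u'0 by (intro DERIV_imp_deriv) (simp add: at_within_atLeast_interior)
qed

section \<open>The value at the interface and the convergence rate\<close>

lemma bounded_if_tendsto_0_at_top:
  fixes u :: "real \<Rightarrow> real"
  assumes "continuous_on {0..} u" "(u \<longlongrightarrow> 0) at_top"
  obtains U where "U \<ge> 0" "\<And>x. x \<ge> 0 \<Longrightarrow> \<bar>u x\<bar> \<le> U"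
proof -
  have "\<forall>\<^sub>F x in at_top. \<bar>u x\<bar> < 1"
    using tendstoD[OF assms(2), of 1] by (simp add: dist_real_def)
  then obtain N where N: "\<And>x. x \<ge> N \<Longrightarrow> \<bar>u x\<bar> < 1"
    by (auto simp: eventually_at_top_linorder)
  have "compact (u ` {0..N})"
    by (intro compact_continuous_image continuous_on_subset[OF assms(1)]) auto
  then obtain b where b: "\<And>x. x \<in> {0..N} \<Longrightarrow> \<bar>u x\<bar> \<le> b"
    by (meson compact_imp_bounded bounded_real imageI)
  show ?thesis
  proof (rule that[of "max 1 b"])
    show "\<bar>u x\<bar> \<le> max 1 b" if "x \<ge> 0" for x
      using N[of x] b[of x] that by (cases "x \<le> N") auto
  qed simp
qed

text \<open>With \<open>w = u - a * x\<close>, the expression \<open>w'' - w / \<eta>\<close>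
  factors as \<open>(d/dx - 1/s) (d/dx + 1/s) w\<close>. The inner factor
  \<open>q = w' + w / s\<close> removes the decaying mode and leaves a first-order equation.
  Subtracting \<open>a * x\<close> makes the forcing small near 0 and \<open>w'\<close> vanish at
  0.\<close>

lemma penalized_solution_at_0_bound:
  assumes sol: "penalized_solution \<eta> g u" and \<eta>: "\<eta> > 0"
    and bdd: "\<And>x. x \<ge> 0 \<Longrightarrow> \<bar>g x\<bar> \<le> M"
    and rem: "\<And>x. x \<ge> 0 \<Longrightarrow> \<bar>g x - deriv u 0 * x\<bar> \<le> K * x ^ Suc k"
  shows "\<bar>u 0\<bar> \<le> K * fact (Suc k) * sqrt \<eta> ^ Suc k"
proof -
  obtain u' where cont: "continuous_on {-1..} u'"
    and der: "\<And>x. x \<ge> -1 \<Longrightarrow> (u has_real_derivative u' x) (at x within {-1..})"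
    and der2: "\<And>x. x > 0 \<Longrightarrow> (u' has_real_derivative (u x - g x) / \<eta>) (at x)"
    using penalized_solution_derivs[OF sol] by metis
  define a s where "a = deriv u 0" and "s = sqrt \<eta>"
  have s: "s > 0" "s\<^sup>2 = \<eta>" using \<eta> by (auto simp: s_def)
  have u'0: "u' 0 = a"
    using der[of 0] unfolding a_def
    by (intro DERIV_imp_deriv[symmetric]) (simp add: at_within_atLeast_interior)
  have contu: "continuous_on {0..} u"
    by (intro DERIV_continuous_on[of _ u u'] DERIV_subset[OF der]) auto
  have contu': "continuous_on {0..} u'"
    by (rule continuous_on_subset[OF cont]) auto
  obtain U where U: "U \<ge> 0" "\<And>x. x \<ge> 0 \<Longrightarrow> \<bar>u x\<bar> \<le> U"
    using bounded_if_tendsto_0_at_top[OF contu] sol by (auto simp: penalized_solution_def)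
  define q where "q x = (u' x - a) + (u x - a * x) / s" for x
  have contq: "continuous_on {0..} q"
    unfolding q_def using s by (intro continuous_intros contu contu') auto
  have derq: "(q has_real_derivative (q x / s - (g x - a * x) / \<eta>)) (at x)" if "x > 0" for x
  proof -
    have "(u has_real_derivative u' x) (at x)"
      using der[of x] that by (simp add: at_within_atLeast_interior)
    then have "(q has_real_derivative ((u x - g x) / \<eta> + (u' x - a) / s)) (at x)"
      unfolding q_def using s(1) by (auto intro!: derivative_eq_intros der2[OF that])
    moreover have "(u x - g x) / \<eta> + (u' x - a) / s = q x / s - (g x - a * x) / \<eta>"
      unfolding q_def s(2)[symmetric] using s(1) by (simp add: field_simps power2_eq_square)
    ultimately show ?thesis by simp
  qed
  \<comment> \<open>Decay of \<open>u\<close> gives no direct control of \<open>u'\<close>, so its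
    growth is read off the equation. The factor \<open>1 / \<eta>\<close> is harmless: the bound
    serves only a limit at fixed \<open>\<eta>\<close>.\<close>
  have u'_growth: "\<bar>u' x - a\<bar> \<le> (U + M) / \<eta> * x" if "x \<ge> 0" for x
  proof -
    have "\<bar>u' x - u' 0\<bar> \<le> (U + M) / \<eta> * (x - 0)"
    proof (rule mvt_abs_bound[where f' = "\<lambda>x. (u x - g x) / \<eta>"])
      show "continuous_on {0..x} u'" by (rule continuous_on_subset[OF contu']) auto
      show "\<bar>(u z - g z) / \<eta>\<bar> \<le> (U + M) / \<eta>" if "0 < z" for z
        using U(2)[of z] bdd[of z] that \<eta> by (auto simp: abs_divide intro!: divide_right_mono)
    qed (use that der2 in auto)
    then show ?thesis using u'0 by simp
  qed
  have lim: "((\<lambda>x. q x * exp (- (x / s))) \<longlongrightarrow> 0) at_top"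
  proof (rule Lim_null_comparison)
    let ?A = "(U + M) / \<eta> + \<bar>a\<bar> / s"
    have "((\<lambda>x. ?A * (x ^ 1 * exp (- (x / s))) + U / s * (x ^ 0 * exp (- (x / s))))
        \<longlongrightarrow> ?A * 0 + U / s * 0) at_top"
      by (intro tendsto_add tendsto_mult_left power_times_exp_tendsto_0 s(1))
    then show "((\<lambda>x. (?A * x + U / s) * exp (- (x / s))) \<longlongrightarrow> 0) at_top"
      by (simp add: algebra_simps)
    have "\<bar>q x\<bar> \<le> ?A * x + U / s" if "x \<ge> 0" for x
    proof -
      have "\<bar>u x - a * x\<bar> \<le> U + \<bar>a\<bar> * x"
        using U(2)[OF that] that abs_mult[of a x] by (simp add: abs_le_iff) linarith
      then have "\<bar>(u x - a * x) / s\<bar> \<le> (U + \<bar>a\<bar> * x) / s"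
        using s by (simp add: divide_right_mono)
      then have "\<bar>q x\<bar> \<le> (U + M) / \<eta> * x + (U + \<bar>a\<bar> * x) / s"
        unfolding q_def using u'_growth[OF that] by linarith
      then show ?thesis by (simp add: algebra_simps add_divide_distrib)
    qed
    then show "\<forall>\<^sub>F x in at_top. norm (q x * exp (- (x / s))) \<le> (?A * x + U / s) * exp (- (x / s))"
      by (intro eventually_mono[OF eventually_ge_at_top[of 0]]) (simp add: abs_mult)
  qed
  have "\<bar>(g x - a * x) / \<eta>\<bar> \<le> K / \<eta> * x ^ Suc k" if "x > 0" for x
    using divide_right_mono[OF rem[of x], of \<eta>] that \<eta> by (simp add: a_def)
  with derq lim have "\<bar>q 0\<bar> \<le> K / \<eta> * fact (Suc k) * s ^ Suc (Suc k)"
    by (intro unstable_mode_bound[OF s(1) contq, where r = "\<lambda>x. (g x - a * x) / \<eta>"]) auto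
  \<comment> \<open>Counting powers of \<open>s\<close>: the Gamma factor gives
    \<open>k + 2\<close>, division by \<open>\<eta>\<close> removes two, and clearing
    \<open>1 / s\<close> restores one, leaving \<open>k + 1\<close>.\<close>
  moreover have "\<bar>q 0\<bar> = \<bar>u 0\<bar> / s" using u'0 s by (simp add: q_def)
  moreover have "K / \<eta> * fact (Suc k) * s ^ Suc (Suc k) * s = K * fact (Suc k) * s ^ Suc k"
    unfolding s(2)[symmetric] using s(1) by (simp add: field_simps power2_eq_square del: fact_Suc)
  ultimately show ?thesis using s(1) unfolding s_def[symmetric]
    by (metis pos_divide_le_eq)
qed

text \<open>Up to \<open>\<delta>\<close> the matching conditions give a Taylor estimate; beyond
  \<open>\<delta>\<close> boundedness of \<open>g\<close> suffices, since powers of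
  \<open>x / \<delta>\<close> are at least 1.\<close>

lemma matching_remainder_bound:
  assumes Ck: "Ck_on (k + 1) {0..} g" and match: "matches_at_0 k g u" and \<delta>: "\<delta> > 0"
    and bdd: "\<And>x. x \<ge> 0 \<Longrightarrow> \<bar>g x\<bar> \<le> M"
    and B: "\<And>x. x \<in> {0..\<delta>} \<Longrightarrow> \<bar>higher_deriv_within {0..} (k + 1) g x\<bar> \<le> B"
    and x: "x \<ge> 0"
  shows "\<bar>g x - deriv u 0 * x\<bar> \<le>
    (1 + B + M / \<delta> ^ Suc k + 1 / \<delta> ^ k) * (1 + \<bar>deriv u 0\<bar>) * x ^ Suc k"
proof -
  let ?a = "deriv u 0"
  \<comment> \<open>The sum of all coefficients that occur: \<open>B\<close> and \<open>1\<close>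
    near 0, \<open>M / \<delta> ^ Suc k\<close> and \<open>1 / \<delta> ^ k\<close> far
    away.\<close>
  let ?C = "1 + B + M / \<delta> ^ Suc k + 1 / \<delta> ^ k"
  have B0: "B \<ge> 0" using B[of 0] \<delta> by force
  have M0: "M \<ge> 0" using bdd[of 0] by simp
  have CK: "K1 + K2 * \<bar>?a\<bar> \<le> ?C * (1 + \<bar>?a\<bar>)" if "K1 \<le> ?C" "K2 \<le> ?C" for K1 K2
    using that(1) mult_right_mono[OF that(2), of "\<bar>?a\<bar>"] by (simp add: distrib_left)
  have pos: "0 \<le> M / \<delta> ^ Suc k" "0 \<le> 1 / \<delta> ^ k" using M0 \<delta> by auto
  show ?thesis
  proof (cases "x \<le> \<delta>")
    case True
    \<comment> \<open>The derivatives of \<open>g\<close> minus the line \<open>?a * z\<close>;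
      matching makes those of order up to \<open>k\<close> vanish at 0.\<close>
    define D where "D m z = higher_deriv_within {0..} m g z -
      (if m = 0 then ?a * z else if m = 1 then ?a else 0)" for m z
    have "\<bar>D 0 x\<bar> \<le> (B + 1 * \<bar>?a\<bar>) * x ^ Suc k"
    proof (rule vanishing_derivs_bound)
      show "(D m has_real_derivative D (Suc m) z) (at z within {0..})" if "m \<le> k" "z \<ge> 0" for m z
        unfolding D_def
        using higher_deriv_within_has_derivative[OF Ck, of m z] that
        by (cases "m = 0"; cases "m = 1") (auto intro!: derivative_eq_intros)
      show "D m 0 = 0" if "m \<le> k" for m
      proof -
        consider "m = 0" | "m = 1" | "m \<in> {2..k}" using \<open>m \<le> k\<close> by fastforce
        then show ?thesis
          using match by cases (auto simp: D_def matches_at_0_def)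
      qed
      \<comment> \<open>The slope \<open>?a\<close> survives in order \<open>Suc k\<close> only when
        \<open>k = 0\<close>; the extra term covers that case.\<close>
      show "\<bar>D (Suc k) z\<bar> \<le> B + 1 * \<bar>?a\<bar>" if "z \<in> {0..\<delta>}" for z
        using B[OF that] by (auto simp: D_def simp del: higher_deriv_within.simps)
    qed (use x True in auto)
    also have "\<dots> \<le> ?C * (1 + \<bar>?a\<bar>) * x ^ Suc k"
      using B0 pos x by (intro mult_right_mono CK) auto
    finally show ?thesis by (simp add: D_def)
  next
    case False
    have one: "1 \<le> x / \<delta>" using False \<delta> by simp
    have "\<bar>g x - ?a * x\<bar> \<le> M + \<bar>?a\<bar> * x"
      using bdd[OF x] x abs_mult[of ?a x] by (simp add: abs_le_iff) linarith
    also have "M \<le> M * (x / \<delta>) ^ Suc k"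
      using mult_left_mono[OF one_le_power[OF one, of "Suc k"] M0] by simp
    \<comment> \<open>The linear term already carries one factor \<open>x\<close>, so only
      \<open>k\<close> further factors are inserted.\<close>
    also have "\<bar>?a\<bar> * x \<le> \<bar>?a\<bar> * (x * (x / \<delta>) ^ k)"
      using x mult_left_mono[OF one_le_power[OF one, of k] x] by (intro mult_left_mono) auto
    also have "M * (x / \<delta>) ^ Suc k + \<bar>?a\<bar> * (x * (x / \<delta>) ^ k) =
        (M / \<delta> ^ Suc k + 1 / \<delta> ^ k * \<bar>?a\<bar>) * x ^ Suc k"
      using \<delta> by (simp add: power_divide distrib_right)
    also have "\<dots> \<le> ?C * (1 + \<bar>?a\<bar>) * x ^ Suc k"
      using B0 pos x by (intro mult_right_mono CK) auto
    finally show ?thesis by simp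
  qed
qed

text \<open>Since \<open>g\<close> varies with \<open>\<eta>\<close>, the constant in the rate
  relies on \<open>M\<close>, \<open>B\<close> and \<open>\<delta>\<close> being uniform in
  \<open>\<eta>\<close>.\<close>

theorem proposition1:
  fixes k :: nat
    and u g :: "real \<Rightarrow> real \<Rightarrow> real"
    and v :: "real \<Rightarrow> real"
    and \<eta>0 \<delta> B M :: real
  assumes "\<eta>0 > 0"
    and "\<And>\<eta>. \<eta> \<in> {0<..<\<eta>0} \<Longrightarrow> penalized_solution \<eta> (g \<eta>) (u \<eta>)"
    and "nonpenalized_solution v"
    and "\<And>\<eta>. \<eta> \<in> {0<..<\<eta>0} \<Longrightarrow> Ck_on (k + 1) {0..} (g \<eta>)"
    and "\<And>\<eta> x. \<eta> \<in> {0<..<\<eta>0} \<Longrightarrow> x \<ge> 0 \<Longrightarrow> \<bar>g \<eta> x\<bar> \<le> M"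
    and "\<delta> > 0"
    and "\<And>\<eta> x. \<eta> \<in> {0<..<\<eta>0} \<Longrightarrow> x \<in> {0..\<delta>} \<Longrightarrow>
           \<bar>higher_deriv_within {0..} (k + 1) (g \<eta>) x\<bar> \<le> B"
    and "\<And>\<eta>. \<eta> \<in> {0<..<\<eta>0} \<Longrightarrow> matches_at_0 k (g \<eta>) (u \<eta>)"
  shows "(\<lambda>\<eta>. SUP x\<in>{-1..0}. \<bar>u \<eta> x - v x\<bar>) \<in> O[at_right 0](\<lambda>\<eta>. \<eta> powr (real (k + 1) / 2))"
proof -
  define C where "C = (1 + B + M / \<delta> ^ Suc k + 1 / \<delta> ^ k) * fact (Suc k)"
  let ?p = "\<lambda>\<eta>. \<eta> powr (real (k + 1) / 2)"
  \<comment> \<open>The error is \<open>u \<eta> 0 * (1 + x)\<close>, largest in modulus at the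
    interface.\<close>
  have sup_eq: "(SUP x\<in>{-1..0}. \<bar>u \<eta> x - v x\<bar>) = \<bar>u \<eta> 0\<bar>" if "\<eta> \<in> {0<..<\<eta>0}" for \<eta>
  proof (rule cSup_eq_maximum)
    note sol = assms(2)[OF that]
    have diff: "\<bar>u \<eta> x - v x\<bar> = \<bar>u \<eta> 0\<bar> * (1 + x)" if "x \<in> {-1..0}" for x
      using penalized_solution_affine(1)[OF sol that] nonpenalized_solution_eq[OF assms(3) that] that
      by (simp add: abs_mult)
    show "\<bar>u \<eta> 0\<bar> \<in> (\<lambda>x. \<bar>u \<eta> x - v x\<bar>) ` {-1..0}"
      using diff[of 0] by (intro image_eqI[of _ _ 0]) auto
    show "y \<le> \<bar>u \<eta> 0\<bar>" if "y \<in> (\<lambda>x. \<bar>u \<eta> x - v x\<bar>) ` {-1..0}" for y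
      using that by (auto simp: diff mult_left_le)
  qed
  have u0_bound: "\<bar>u \<eta> 0\<bar> \<le> C * (2 + \<bar>u \<eta> 0\<bar>) * ?p \<eta>" if \<eta>: "\<eta> \<in> {0<..<\<eta>0}" for \<eta>
  proof -
    have M0: "M \<ge> 0" using assms(5)[OF \<eta>, of 0] by simp
    have B0: "B \<ge> 0" using assms(7)[OF \<eta>, of 0] assms(6) by force
    have C0: "C \<ge> 0" unfolding C_def using M0 B0 assms(6) by (intro mult_nonneg_nonneg) auto
    have p: "sqrt \<eta> ^ Suc k = ?p \<eta>"
      using \<eta> by (simp add: powr_half_sqrt[symmetric] powr_power del: power_Suc)
    have "\<bar>u \<eta> 0\<bar> \<le> (1 + B + M / \<delta> ^ Suc k + 1 / \<delta> ^ k) * (1 + \<bar>deriv (u \<eta>) 0\<bar>)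
        * fact (Suc k) * sqrt \<eta> ^ Suc k"
      using \<eta> matching_remainder_bound[OF assms(4)[OF \<eta>] assms(8)[OF \<eta>] assms(6)
        assms(5)[OF \<eta>] assms(7)[OF \<eta>]]
      by (intro penalized_solution_at_0_bound[OF assms(2)[OF \<eta>] _ assms(5)[OF \<eta>]]) auto
    also have "\<dots> = C * (1 + \<bar>deriv (u \<eta>) 0\<bar>) * ?p \<eta>"
      unfolding p C_def by (simp only: mult_ac)
    \<comment> \<open>The slope at 0 is \<open>u \<eta> 0 - 1\<close>, so the unknown reappears on
      the right.\<close>
    also have "\<dots> \<le> C * (2 + \<bar>u \<eta> 0\<bar>) * ?p \<eta>"
      using C0 penalized_solution_affine(2)[OF assms(2)[OF \<eta>], of 0]
      by (intro mult_right_mono mult_left_mono) auto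
    finally show ?thesis .
  qed
  have "(?p \<longlongrightarrow> 0) (at_right 0)"
    by (rule tendsto_eq_rhs[OF tendsto_zero_powrI[of "\<lambda>\<eta>. \<eta>" _ "\<lambda>_. real (k + 1) / 2"]])
       (auto intro: tendsto_ident_at eventually_at_right_less[THEN eventually_mono])
  then have "((\<lambda>\<eta>. C * ?p \<eta>) \<longlongrightarrow> C * 0) (at_right 0)"
    by (rule tendsto_mult_left)
  then have small: "\<forall>\<^sub>F \<eta> in at_right 0. C * ?p \<eta> < 1 / 2"
    by (rule order_tendstoD) simp
  have "\<forall>\<^sub>F \<eta> in at_right 0. \<eta> \<in> {0<..<\<eta>0}"
    using assms(1) by (rule eventually_at_right_real)
  then have "\<forall>\<^sub>F \<eta> in at_right 0. norm (SUP x\<in>{-1..0}. \<bar>u \<eta> x - v x\<bar>) \<le> 4 * C * norm (?p \<eta>)"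
    using small
  proof eventually_elim
    case (elim \<eta>)
    \<comment> \<open>Absorption: half of \<open>\<bar>u \<eta> 0\<bar>\<close> moves to the left,
      which doubles the remaining \<open>2 * C * ?p \<eta>\<close> and yields the factor 4.\<close>
    have "\<bar>u \<eta> 0\<bar> * (C * ?p \<eta>) \<le> \<bar>u \<eta> 0\<bar> * (1 / 2)"
      using elim(2) by (intro mult_left_mono) auto
    with u0_bound[OF elim(1)] have "\<bar>u \<eta> 0\<bar> \<le> 4 * C * ?p \<eta>"
      by (simp add: algebra_simps)
    then show ?case using sup_eq[OF elim(1)] by simp
  qed
  then show ?thesis by (rule bigoI)
qed

end
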